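(* Let $\boldsymbol{A}\in\mathbb{R}^{n\times n}$, $\boldsymbol{B}\in\mathbb{R}^{n\times m}$, and consider the discrete-time linear dynamical system $\boldsymbol{x}(t+1)=\boldsymbol{A}\boldsymbol{x}(t)+\boldsymbol{B}\boldsymbol{u}(t)$. Let $\lambda_1,\dots,\lambda_p$ be the distinct eigenvalues of $\boldsymbol{A}$, and let $\boldsymbol{W}^{(i)}\in\{0,1\}^{\alpha_i\times m}$, $i\in[p]$, be the matrices built from $(\boldsymbol{A},\boldsymbol{B})$ as described in the context. Then the minimal actuator selection problem $$\mathcal{S}^*\in\operatorname*{arg\,min}_{\mathcal{S}\subseteq[m]}\ |\mathcal{S}|\quad\text{s.t.}\quad \operatorname{rank}\begin{bmatrix}\boldsymbol{A}-\lambda\boldsymbol{I} & \boldsymbol{B}_{\mathcal{S}}\end{bmatrix}=n\quad\forall\lambda\in\sigma(\boldsymbol{A})$$ is equivalent to the binary integer linear program $$\boldsymbol{y}^*\in\operatorname*{arg\,min}_{\boldsymbol{y}\in\{0,1\}^m,\ \boldsymbol{d}^{(i)}\in\{0,1\}^{\alpha_i}}\ \boldsymbol{1}^{\mathsf T}\boldsymbol{y}\quad\text{s.t.}\quad \boldsymbol{W}^{(i)}\boldsymbol{y}\ \ge\ \big(\boldsymbol{W}^{(i)}\boldsymbol{1}\big)\odot\boldsymbol{d}^{(i)}\ \ \forall i\in[p],\qquad \boldsymbol{1}^{\mathsf T}\boldsymbol{d}^{(i)}\ge 1\ \ \forall i\in[p],$$ with the correspondence $\mathcal{S}^*=\operatorname{supp}(\boldsymbol{y}^*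 )$.
   Context: Notation: $[m]=\{1,\dots,m\}$; $\boldsymbol{B}_{\mathcal{S}}$ is the matrix formed by the columns of $\boldsymbol{B}$ with indices in $\mathcal{S}$; $\boldsymbol{M}_{\mathcal{G},\mathcal{S}}$ is the submatrix of $\boldsymbol{M}$ with rows indexed by $\mathcal{G}$ and columns indexed by $\mathcal{S}$; $\sigma(\boldsymbol{A})$ is the set of distinct eigenvalues of $\boldsymbol{A}$, $p=|\sigma(\boldsymbol{A})|$; $\boldsymbol{1}$ is the all-ones vector; $\odot$ is the entrywise (Hadamard) product; $\operatorname{supp}(\boldsymbol{y})=\{j:y_j\neq0\}$; vector inequalities are entrywise. The rank constraint is the Popov-Belevitch-Hautus condition, equivalent to controllability of $(\boldsymbol{A},\boldsymbol{B}_{\mathcal{S}})$. Construction of $\boldsymbol{W}^{(i)}$: compute a Jordan decomposition $\boldsymbol{A}=\boldsymbol{P}\boldsymbol{J}\boldsymbol{P}^{-1}$ with $\boldsymbol{J}$ in upper triangular Jordan form (over $\mathbb{C}$ if $\boldsymbol{A}$ has nonreal eigenvalues). Let $g_i$ be the geometric multiplicity of $\lambda_i$, and let $\bar{\boldsymbol{B}}=\boldsymbol{P}^{-1}\boldsymbol{B}$. For each $i\in[p]$, let $\mathcal{G}_i$ be the set of indices of the $g_i$ zero rows of $\boldsymbol{J}-\lambda_i\boldsymbol{I}$. Let $\mathcal{S}^{(k)}$, $k\in[\alpha_i]$, enumerate all subsets of $[m]$ with $|\mathcal{S}^{(k)}|=g_i$ and $\operatorname{rank}\bar{\boldsymbol{B}}_{\mathcal{G}_i,\mathcal{S}^{(k)}}=g_i$.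 Then $\boldsymbol{W}^{(i)}\in\{0,1\}^{\alpha_i\times m}$ is defined by $[\boldsymbol{W}^{(i)}]_{kj}=1\iff j\in\mathcal{S}^{(k)}$. (If $\alpha_i=0$, the constraint $\boldsymbol{1}^{\mathsf T}\boldsymbol{d}^{(i)}\ge1$ is infeasible.) "Equivalent" means that the optimal solutions $\mathcal{S}^*$ of the first problem are exactly the sets $\operatorname{supp}(\boldsymbol{y}^* )$ for optimal solutions $\boldsymbol{y}^*$ of the second. *)

theory Defs
  imports
    "Jordan_Normal_Form.Jordan_Normal_Form_Uniqueness"
    "Jordan_Normal_Form.Spectral_Radius"
    "Jordan_Normal_Form.DL_Rank_Submatrix"
begin

text \<open>
  Real matrices are embedded into the complex ones, so that nonreal eigenvalues and Jordan
  decompositions are available; rank does not change under this field extension.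
  Indices start at 0, so the index set of m actuators is \<open>{..<m}\<close>.
\<close>

abbreviation cmat :: "real mat \<Rightarrow> complex mat" where
  "cmat \<equiv> map_mat complex_of_real"

definition mat_rank :: "complex mat \<Rightarrow> nat" where
  "mat_rank M = vec_space.rank (dim_row M) M"

definition append_cols :: "'a :: zero mat \<Rightarrow> 'a mat \<Rightarrow> 'a mat" where
  "append_cols M N = four_block_mat M N (0\<^sub>m 0 (dim_col M)) (0\<^sub>m 0 (dim_col N))"

definition select_cols :: "'a mat \<Rightarrow> nat set \<Rightarrow> 'a mat" where
  "select_cols B S = submatrix B UNIV S"


definition selection_feasible :: "real mat \<Rightarrow> real mat \<Rightarrow> nat set \<Rightarrow> bool" where
  "selection_feasible A B S \<longleftrightarrow>
     S \<subseteq> {..<dim_col B} \<and>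
     (\<forall>\<mu> \<in> spectrum (cmat A).
        mat_rank (append_cols (cmat A - \<mu> \<cdot>\<^sub>m 1\<^sub>m (dim_row A)) (select_cols (cmat B) S)) = dim_row A)"


definition jordan_decomposition ::
  "complex mat \<Rightarrow> complex mat \<Rightarrow> complex mat \<Rightarrow> complex mat \<Rightarrow> bool" where
  "jordan_decomposition A P J Pinv \<longleftrightarrow>
     similar_mat_wit A J P Pinv \<and>
     (\<exists>n_as. 0 \<notin> fst ` set n_as \<and> J = jordan_matrix n_as)"

definition geom_mult :: "complex mat \<Rightarrow> complex \<Rightarrow> nat" where
  "geom_mult A \<mu> = kernel_dim (A - \<mu> \<cdot>\<^sub>m 1\<^sub>m (dim_row A))"

definition zero_rows :: "complex mat \<Rightarrow> complex \<Rightarrow> nat set" where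
  "zero_rows J \<mu> = {r. r < dim_row J \<and>
     row (J - \<mu> \<cdot>\<^sub>m 1\<^sub>m (dim_row J)) r = 0\<^sub>v (dim_col J)}"

definition admissible_subsets ::
  "complex mat \<Rightarrow> complex mat \<Rightarrow> complex mat \<Rightarrow> complex \<Rightarrow> nat set set" where
  "admissible_subsets A J Bbar \<mu> = {T. T \<subseteq> {..<dim_col Bbar} \<and> card T = geom_mult A \<mu> \<and>
     mat_rank (submatrix Bbar (zero_rows J \<mu>) T) = geom_mult A \<mu>}"

text \<open>
  The rows of W may come in any order: \<open>Ts\<close> lists every admissible subset exactly once.
\<close>

definition is_incidence_mat :: "nat \<Rightarrow> nat set set \<Rightarrow> int mat \<Rightarrow> bool" where
  "is_incidence_mat m \<T> W \<longleftrightarrow>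
     (\<exists>Ts. distinct Ts \<and> set Ts = \<T> \<and>
        W = mat (length Ts) m (\<lambda>(k, j). if j \<in> Ts ! k then 1 else 0))"


definition binary_vecs :: "nat \<Rightarrow> int vec set" where
  "binary_vecs k = {v \<in> carrier_vec k. \<forall>j<k. v $ j \<in> {0, 1}}"

definition ones_vec :: "nat \<Rightarrow> int vec" where
  "ones_vec k = vec k (\<lambda>_. 1)"

definition hadamard :: "int vec \<Rightarrow> int vec \<Rightarrow> int vec" where
  "hadamard u v = vec (dim_vec u) (\<lambda>j. u $ j * v $ j)"

definition supp_vec :: "int vec \<Rightarrow> nat set" where
  "supp_vec y = {j. j < dim_vec y \<and> y $ j \<noteq> 0}"

text \<open>
  Only the components \<open>W i\<close> and \<open>d i\<close> with \<open>i < p\<close> are meaningful.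
\<close>

definition ilp_feasible ::
  "nat \<Rightarrow> nat \<Rightarrow> (nat \<Rightarrow> int mat) \<Rightarrow> int vec \<times> (nat \<Rightarrow> int vec) \<Rightarrow> bool" where
  "ilp_feasible m p W = (\<lambda>(y, d).
     y \<in> binary_vecs m \<and>
     (\<forall>i<p. d i \<in> binary_vecs (dim_row (W i))) \<and>
     (\<forall>i<p. W i *\<^sub>v y \<ge> hadamard (W i *\<^sub>v ones_vec m) (d i)) \<and>
     (\<forall>i<p. ones_vec (dim_row (W i)) \<bullet> d i \<ge> 1))"

definition ilp_objective :: "nat \<Rightarrow> int vec \<times> (nat \<Rightarrow> int vec) \<Rightarrow> int" where
  "ilp_objective m = (\<lambda>(y, d). ones_vec m \<bullet> y)"

end

theory Submission
  imports Defs
begin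

text \<open>
  The matrix [A - \<mu> I, B_S] has full row rank iff it is surjective. Changing coordinates by P
  turns this into surjectivity of [J - \<mu> I, Bbar_S]; the range of J - \<mu> I consists of the
  vectors that vanish on its zero rows G, so the condition says that the rows G of Bbar_S have full
  rank. By Gaussian elimination this holds iff some card G columns in S already form an
  invertible minor, and card G is the geometric multiplicity of \<mu>. So S is feasible iff
  it contains an admissible subset for every eigenvalue, which is what the binary program
  expresses: d selects a row of W, and the constraint of a selected row forces the
  corresponding subset into the support of y.
\<close>

section \<open>Full rank as surjectivity\<close>

text \<open>The columns span the range. A maximal independent set of columns has
  \<open>rank A\<close> elements, and \<open>n\<close> independent vectors in an
  \<open>n\<close>-dimensional space form a basis.\<close>

lemma (in vec_space) rank_eq_n_iff:
  assumes A: "A \<in> carrier_mat n nc"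
  shows "rank A = n \<longleftrightarrow> (\<forall>w\<in>carrier_vec n. \<exists>x\<in>carrier_vec nc. A *\<^sub>v x = w)"
proof -
  have cols: "set (cols A) \<subseteq> carrier V" using A cols_dim[of A] by auto
  have range: "span (set (cols A)) = {y \<in> carrier_vec n. \<exists>x\<in>carrier_vec nc. A *\<^sub>v x = y}"
    using col_space_eq[OF A] A unfolding col_space_def by auto
  have "rank A = n \<longleftrightarrow> span (set (cols A)) = carrier V"
  proof
    assume r: "rank A = n"
    obtain S where S: "maximal S (\<lambda>T. T \<subseteq> set (cols A) \<and> lin_indpt T)" "finite S"
      using maximal_exists_superset[of "set (cols A)" "\<lambda>T. T \<subseteq> set (cols A) \<and> lin_indpt T" "{}"]
      by (metis (no_types, lifting) List.finite_set empty_subsetI finite_lin_indpt2 finite.emptyI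
          subset_li_is_li unit_vecs_basis basis_def)
    have ind: "S \<subseteq> set (cols A)" "lin_indpt S" using S(1) unfolding maximal_def by auto
    have "card S = n" using rank_card_indpt[OF A S(1)] r by simp
    hence "basis S"
      using dim_li_is_basis[OF fin_dim S(2)] ind cols dim_is_n by auto
    hence "span S = carrier V" unfolding basis_def by auto
    thus "span (set (cols A)) = carrier V"
      using span_is_monotone[OF ind(1)] span_is_subset2[of "set (cols A)"] cols by auto
  next
    assume "span (set (cols A)) = carrier V"
    hence "span_vs (set (cols A)) = V" by simp
    thus "rank A = n" unfolding rank_def using dim_is_n by simp
  qed
  thus ?thesis unfolding range by auto
qed

section \<open>Full row rank over arbitrary index sets\<close>

text \<open>Surjectivity of the linear map given by the array \<open>f\<close>. Working with
  functions and index sets instead of matrices lets elimination delete rows and columns without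
  renumbering.\<close>

definition full_row_rank :: "('i \<Rightarrow> 'j \<Rightarrow> 'a :: field) \<Rightarrow> 'i set \<Rightarrow> 'j set \<Rightarrow> bool" where
  "full_row_rank f G T \<longleftrightarrow> (\<forall>w. \<exists>u. \<forall>i\<in>G. (\<Sum>j\<in>T. f i j * u j) = w i)"

lemma full_row_rankD:
  "full_row_rank f G T \<Longrightarrow> \<exists>u. \<forall>i\<in>G. (\<Sum>j\<in>T. f i j * u j) = w i"
  unfolding full_row_rank_def by blast

lemma full_row_rank_mono:
  assumes f: "full_row_rank f G T" and "T \<subseteq> S" "finite S"
  shows "full_row_rank f G S"
  unfolding full_row_rank_def
proof
  fix w
  from f obtain u where u: "\<forall>i\<in>G. (\<Sum>j\<in>T. f i j * u j) = w i"
    unfolding full_row_rank_def by blast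
  have "(\<Sum>j\<in>S. f i j * (if j \<in> T then u j else 0)) = (\<Sum>j\<in>T. f i j * u j)" for i
    by (rule sum.mono_neutral_cong_right) (use assms in auto)
  with u show "\<exists>u. \<forall>i\<in>G. (\<Sum>j\<in>S. f i j * u j) = w i"
    by (intro exI[of _ "\<lambda>j. if j \<in> T then u j else 0"]) simp
qed

text \<open>Needed because \<open>submatrix\<close> renumbers its rows and columns, while the
  elimination argument keeps the original indices.\<close>

lemma full_row_rank_reindex:
  assumes p: "bij_betw p G' G" and q: "bij_betw q T' T"
  shows "full_row_rank (\<lambda>i j. f (p i) (q j)) G' T' \<longleftrightarrow> full_row_rank f G T"
proof -
  have sums: "(\<Sum>j\<in>T'. f i (q j) * u (q j)) = (\<Sum>j\<in>T. f i j * u j)" for i u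
    using sum.reindex_bij_betw[OF q, of "\<lambda>j. f i j * u j"] .
  have G: "G = p ` G'" using p by (simp add: bij_betw_def)
  show ?thesis
  proof
    assume L: "full_row_rank (\<lambda>i j. f (p i) (q j)) G' T'"
    show "full_row_rank f G T" unfolding full_row_rank_def
    proof
      fix w
      obtain u where u: "\<forall>i\<in>G'. (\<Sum>j\<in>T'. f (p i) (q j) * u j) = w (p i)"
        using full_row_rankD[OF L, of "\<lambda>i. w (p i)"] by blast
      define v where "v j = u (inv_into T' q j)" for j
      have "v (q j) = u j" if "j \<in> T'" for j
        using that q by (simp add: v_def bij_betw_def)
      hence "(\<Sum>j\<in>T. f i j * v j) = (\<Sum>j\<in>T'. f i (q j) * u j)" for i
        unfolding sums[symmetric] by simp
      thus "\<exists>u. \<forall>i\<in>G. (\<Sum>j\<in>T. f i j * u j) = w i"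
        using u unfolding G by (intro exI[of _ v]) simp
    qed
  next
    assume R: "full_row_rank f G T"
    show "full_row_rank (\<lambda>i j. f (p i) (q j)) G' T'" unfolding full_row_rank_def
    proof
      fix w
      obtain u where u: "\<forall>i\<in>G. (\<Sum>j\<in>T. f i j * u j) = w (inv_into G' p i)"
        using full_row_rankD[OF R, of "\<lambda>i. w (inv_into G' p i)"] by blast
      show "\<exists>u. \<forall>i\<in>G'. (\<Sum>j\<in>T'. f (p i) (q j) * u j) = w i"
        by (rule exI[of _ "\<lambda>j. u (q j)"]) (use u p G in \<open>auto simp: sums bij_betw_def\<close>)
    qed
  qed
qed

lemma full_row_rank_cong:
  assumes "\<And>i j. i \<in> G \<Longrightarrow> j \<in> T \<Longrightarrow> f i j = g i j"
  shows "full_row_rank f G T \<longleftrightarrow> full_row_rank g G T"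
  unfolding full_row_rank_def using assms by simp

text \<open>Each row contributes one pivot column: clear column \<open>k\<close> in the other rows,
  apply the induction hypothesis to those rows without column \<open>k\<close>, then put
  \<open>k\<close> back.\<close>

lemma full_row_rank_extract:
  assumes "finite G" "finite S" "full_row_rank f G S"
  shows "\<exists>T\<subseteq>S. card T = card G \<and> full_row_rank f G T"
  using assms
proof (induction G arbitrary: S f rule: finite_induct)
  case empty
  show ?case by (intro exI[of _ "{}"]) (simp add: full_row_rank_def)
next
  case (insert g G S f)
  \<comment> \<open>Row \<open>g\<close> attains the value 1, so it has a nonzero entry to serve as
    pivot.\<close>
  obtain u1 where "(\<Sum>j\<in>S. f g j * u1 j) = 1"
    using full_row_rankD[OF insert.prems(2), of "\<lambda>_. 1"] by auto
  then obtain k where k: "k \<in> S" "f g k \<noteq> 0"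
    by (metis (no_types, lifting) mult_zero_left sum.neutral zero_neq_one)
  define c where "c i = f i k / f g k" for i
  \<comment> \<open>The array after subtracting multiples of the pivot row; its column
    \<open>k\<close> vanishes.\<close>
  define h where "h i j = f i j - c i * f g j" for i j
  have hk: "h i k = 0" for i unfolding h_def c_def using k by simp
  have hsum: "(\<Sum>j\<in>X. h i j * u j) = (\<Sum>j\<in>X. f i j * u j) - c i * (\<Sum>j\<in>X. f g j * u j)" for X i u
    unfolding h_def by (simp add: left_diff_distrib sum_subtractf sum_distrib_left mult.assoc)
  have "full_row_rank h G (S - {k})" unfolding full_row_rank_def
  proof
    fix w
    obtain u where u: "\<forall>i\<in>insert g G. (\<Sum>j\<in>S. f i j * u j) = (if i = g then 0 else w i)"
      using full_row_rankD[OF insert.prems(2), of "\<lambda>i. if i = g then 0 else w i"] by blast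
    have "(\<Sum>j\<in>S - {k}. h i j * u j) = (\<Sum>j\<in>S. h i j * u j)" for i
      using insert.prems(1) k hk by (simp add: sum.remove)
    thus "\<exists>u. \<forall>i\<in>G. (\<Sum>j\<in>S - {k}. h i j * u j) = w i"
      using u insert.hyps by (intro exI[of _ u]) (auto simp: hsum)
  qed
  then obtain T where T: "T \<subseteq> S - {k}" "card T = card G" "full_row_rank h G T"
    using insert.IH[of "S - {k}" h] insert.prems(1) by blast
  have fT: "finite T" and kT: "k \<notin> T" using T(1) insert.prems(1) finite_subset by auto
  have "full_row_rank f (insert g G) (insert k T)" unfolding full_row_rank_def
  proof
    fix w
    \<comment> \<open>The target is corrected in advance by the multiple of row \<open>g\<close>
      that separates \<open>h\<close> from \<open>f\<close>.\<close>
    obtain u where u: "\<forall>i\<in>G. (\<Sum>j\<in>T. h i j * u j) = w i - c i * w g"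
      using full_row_rankD[OF T(3), of "\<lambda>i. w i - c i * w g"] by blast
    \<comment> \<open>The coefficient at \<open>k\<close> is tuned to make row \<open>g\<close>
      correct; the rows of \<open>h\<close> do not notice it.\<close>
    define v where "v = u(k := (w g - (\<Sum>j\<in>T. f g j * u j)) / f g k)"
    have vT: "(\<Sum>j\<in>T. x j * v j) = (\<Sum>j\<in>T. x j * u j)" for x
      unfolding v_def using kT by (intro sum.cong) auto
    have g: "(\<Sum>j\<in>insert k T. f g j * v j) = w g"
      using k by (simp add: fT kT vT) (simp add: v_def)
    have "(\<Sum>j\<in>insert k T. f i j * v j) = w i" if "i \<in> G" for i
    proof -
      have "(\<Sum>j\<in>insert k T. h i j * v j) = w i - c i * w g"
        using u that by (simp add: fT kT vT hk)
      thus ?thesis unfolding hsum g by simp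
    qed
    with g show "\<exists>u. \<forall>i\<in>insert g G. (\<Sum>j\<in>insert k T. f i j * u j) = w i" by blast
  qed
  moreover have "insert k T \<subseteq> S" "card (insert k T) = card (insert g G)"
    using T k fT kT insert.hyps by auto
  ultimately show ?case by blast
qed

section \<open>Matrices and submatrices\<close>

lemma mat_rank_eq_dim_row_iff:
  "mat_rank M = dim_row M \<longleftrightarrow>
     (\<forall>w\<in>carrier_vec (dim_row M). \<exists>x\<in>carrier_vec (dim_col M). M *\<^sub>v x = w)"
  unfolding mat_rank_def by (rule vec_space.rank_eq_n_iff) simp

lemma mult_mat_vec_surj_iff_full_row_rank:
  "(\<forall>w\<in>carrier_vec (dim_row M). \<exists>x\<in>carrier_vec (dim_col M). M *\<^sub>v x = w) \<longleftrightarrow>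
     full_row_rank (\<lambda>i j. M $$ (i, j)) {..<dim_row M} {..<dim_col M}"
proof -
  have entry: "(M *\<^sub>v x) $ i = (\<Sum>j<dim_col M. M $$ (i, j) * x $ j)"
    if "i < dim_row M" "x \<in> carrier_vec (dim_col M)" for i x
    using that by (simp add: scalar_prod_def lessThan_atLeast0)
  show ?thesis
  proof
    assume L: "\<forall>w\<in>carrier_vec (dim_row M). \<exists>x\<in>carrier_vec (dim_col M). M *\<^sub>v x = w"
    show "full_row_rank (\<lambda>i j. M $$ (i, j)) {..<dim_row M} {..<dim_col M}"
      unfolding full_row_rank_def
    proof
      fix w
      obtain x where x: "x \<in> carrier_vec (dim_col M)" "M *\<^sub>v x = vec (dim_row M) w"
        using L by fastforce
      show "\<exists>u. \<forall>i\<in>{..<dim_row M}. (\<Sum>j<dim_col M. M $$ (i, j) * u j) = w i"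
        by (rule exI[of _ "\<lambda>j. x $ j"]) (use x in \<open>simp add: entry[symmetric]\<close>)
    qed
  next
    assume R: "full_row_rank (\<lambda>i j. M $$ (i, j)) {..<dim_row M} {..<dim_col M}"
    show "\<forall>w\<in>carrier_vec (dim_row M). \<exists>x\<in>carrier_vec (dim_col M). M *\<^sub>v x = w"
    proof
      fix w :: "'a vec" assume w: "w \<in> carrier_vec (dim_row M)"
      obtain u where u: "\<forall>i\<in>{..<dim_row M}. (\<Sum>j<dim_col M. M $$ (i, j) * u j) = w $ i"
        using full_row_rankD[OF R, of "\<lambda>i. w $ i"] by blast
      have "M *\<^sub>v vec (dim_col M) u = w"
        by (rule eq_vecI) (use u w in \<open>simp_all add: entry del: index_mult_mat_vec\<close>)
      thus "\<exists>x\<in>carrier_vec (dim_col M). M *\<^sub>v x = w" by (metis vec_carrier)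
    qed
  qed
qed

text \<open>\<open>pick T\<close> is strictly increasing, hence injective, and its image is a subset
  of the finite set \<open>T\<close> with as many elements.\<close>

lemma bij_betw_pick:
  assumes "T \<subseteq> {..<k}"
  shows "bij_betw (pick T) {..<card T} T"
proof -
  have inj: "inj_on (pick T) {..<card T}"
    by (rule strict_mono_on_imp_inj_on) (auto simp: strict_mono_on_def intro: pick_mono_le)
  moreover have "pick T ` {..<card T} \<subseteq> T" using pick_in_set_le by auto
  ultimately show ?thesis
    by (simp add: bij_betw_def card_image card_subset_eq finite_subset[OF assms])
qed

lemma full_row_rank_submatrix:
  assumes G: "G \<subseteq> {..<dim_row M}" and T: "T \<subseteq> {..<dim_col M}"
  defines "N \<equiv> submatrix M G T"
  shows "full_row_rank (\<lambda>i j. N $$ (i, j)) {..<dim_row N} {..<dim_col N}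
    \<longleftrightarrow> full_row_rank (\<lambda>i j. M $$ (i, j)) G T"
proof -
  have sets: "{i. i < dim_row M \<and> i \<in> G} = G" "{j. j < dim_col M \<and> j \<in> T} = T"
    using G T by auto
  have "full_row_rank (\<lambda>i j. N $$ (i, j)) {..<dim_row N} {..<dim_col N}
    \<longleftrightarrow> full_row_rank (\<lambda>i j. M $$ (pick G i, pick T j)) {..<card G} {..<card T}"
    unfolding N_def dim_submatrix sets
    by (rule full_row_rank_cong) (simp add: submatrix_index sets)
  thus ?thesis
    using full_row_rank_reindex[OF bij_betw_pick[OF G] bij_betw_pick[OF T], of "\<lambda>i j. M $$ (i, j)"]
    by simp
qed

text \<open>This is the rank test of \<open>admissible_subsets\<close>, once the geometric
  multiplicity is known to equal the number of selected rows.\<close>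

lemma mat_rank_submatrix_eq_card_iff:
  assumes "G \<subseteq> {..<dim_row M}" "T \<subseteq> {..<dim_col M}"
  shows "mat_rank (submatrix M G T) = card G \<longleftrightarrow> full_row_rank (\<lambda>i j. M $$ (i, j)) G T"
proof -
  have "{i. i < dim_row M \<and> i \<in> G} = G" using assms by auto
  thus ?thesis
    using mat_rank_eq_dim_row_iff[of "submatrix M G T"]
    unfolding mult_mat_vec_surj_iff_full_row_rank full_row_rank_submatrix[OF assms]
    by (simp add: dim_submatrix(1))
qed

section \<open>Joint surjectivity and change of coordinates\<close>

text \<open>Surjectivity of the block matrix \<open>[M C]\<close> with the argument split, so that a
  similarity can transform \<open>x\<close> and leave \<open>u\<close> alone.\<close>

definition jointly_surjective :: "'a :: semiring_0 mat \<Rightarrow> 'a mat \<Rightarrow> bool" where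
  "jointly_surjective M C \<longleftrightarrow>
     (\<forall>w\<in>carrier_vec (dim_row M). \<exists>x\<in>carrier_vec (dim_col M). \<exists>u\<in>carrier_vec (dim_col C).
        M *\<^sub>v x + C *\<^sub>v u = w)"

lemma mat_rank_append_cols_iff:
  assumes M: "M \<in> carrier_mat n k" and C: "C \<in> carrier_mat n l"
  shows "mat_rank (append_cols M C) = n \<longleftrightarrow> jointly_surjective M C"
proof -
  have dims: "dim_row (append_cols M C) = n" "dim_col (append_cols M C) = k + l"
    using M C by (auto simp: append_cols_def)
  have mult: "append_cols M C *\<^sub>v (x @\<^sub>v u) = M *\<^sub>v x + C *\<^sub>v u"
    if x: "x \<in> carrier_vec k" and u: "u \<in> carrier_vec l" for x u
    unfolding append_cols_def
    by (subst four_block_mat_mult_vec[of _ n k _ l _ 0]) (use M C x u in auto)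
  have "mat_rank (append_cols M C) = n \<longleftrightarrow>
      (\<forall>w\<in>carrier_vec n. \<exists>v\<in>carrier_vec (k + l). append_cols M C *\<^sub>v v = w)"
    using mat_rank_eq_dim_row_iff[of "append_cols M C"] unfolding dims .
  also have "\<dots> \<longleftrightarrow> (\<forall>w\<in>carrier_vec n. \<exists>x\<in>carrier_vec k. \<exists>u\<in>carrier_vec l.
      append_cols M C *\<^sub>v (x @\<^sub>v u) = w)"
    \<comment> \<open>The splitting rule is universal; applying it to the negated equation gives the
      existential form.\<close>
    using all_vec_append[where P = "\<lambda>v. append_cols M C *\<^sub>v v \<noteq> _"] by blast
  also have "\<dots> \<longleftrightarrow> jointly_surjective M C"
    using M C unfolding jointly_surjective_def by (simp add: mult)
  finally show ?thesis .
qed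

text \<open>Solve for the target \<open>P *\<^sub>v w\<close>, then multiply by \<open>Q\<close>,
  the inverse of \<open>P\<close>. Since \<open>Q * M = N * Q\<close>, the state becomes
  \<open>Q *\<^sub>v x\<close> and the input \<open>u\<close> is unchanged.\<close>

lemma jointly_surjective_similar:
  fixes M :: "'a :: field mat"
  assumes sim: "similar_mat_wit M N P Q" and M: "M \<in> carrier_mat n n"
    and C: "C \<in> carrier_mat n l" and surj: "jointly_surjective M C"
  shows "jointly_surjective N (Q * C)"
  unfolding jointly_surjective_def
proof
  note wit = similar_mat_witD2(1-2,4-)[OF M sim]
  fix w :: "'a vec" assume "w \<in> carrier_vec (dim_row N)"
  hence w: "w \<in> carrier_vec n" using wit by auto
  hence "P *\<^sub>v w \<in> carrier_vec (dim_row M)" using wit M by auto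
  then obtain x u where x: "x \<in> carrier_vec n" and u: "u \<in> carrier_vec l"
    and eq: "M *\<^sub>v x + C *\<^sub>v u = P *\<^sub>v w"
    using surj M C unfolding jointly_surjective_def by auto
  have QM: "Q * M = N * Q"
  proof -
    have "Q * M = (Q * P) * (N * Q)"
      unfolding similar_mat_witD2(3)[OF M sim] using wit(3-) by (simp add: assoc_mult_mat[of _ n n _ n _ n])
    thus ?thesis unfolding wit(2) using wit by simp
  qed
  have "w = Q *\<^sub>v (P *\<^sub>v w)" using wit w by (simp flip: assoc_mult_mat_vec)
  also have "\<dots> = Q *\<^sub>v (M *\<^sub>v x) + Q *\<^sub>v (C *\<^sub>v u)"
    unfolding eq[symmetric] using wit M C x u by (intro mult_add_distrib_mat_vec) auto
  also have "Q *\<^sub>v (M *\<^sub>v x) = N *\<^sub>v (Q *\<^sub>v x)"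
    using assoc_mult_mat_vec[OF wit(6) M x] assoc_mult_mat_vec[OF wit(4,6) x] unfolding QM by simp
  also have "Q *\<^sub>v (C *\<^sub>v u) = (Q * C) *\<^sub>v u" using wit C u by simp
  finally show "\<exists>x\<in>carrier_vec (dim_col N). \<exists>u\<in>carrier_vec (dim_col (Q * C)).
      N *\<^sub>v x + (Q * C) *\<^sub>v u = w"
    using wit C u x by (intro bexI[of _ "Q *\<^sub>v x"] bexI[of _ u]) auto
qed

lemma jointly_surjective_similar_iff:
  fixes M :: "'a :: field mat"
  assumes sim: "similar_mat_wit M N P Q" and M: "M \<in> carrier_mat n n"
    and C: "C \<in> carrier_mat n l"
  shows "jointly_surjective M C \<longleftrightarrow> jointly_surjective N (Q * C)"
proof
  assume "jointly_surjective N (Q * C)"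
  note wit = similar_mat_witD2(1-2,4-)[OF M sim]
  have "jointly_surjective M (P * (Q * C))"
    by (rule jointly_surjective_similar[OF similar_mat_wit_sym[OF sim]])
      (use wit C \<open>jointly_surjective N (Q * C)\<close> in auto)
  moreover have "P * (Q * C) = C"
    using wit C by (simp flip: assoc_mult_mat[of _ n n _ n _ l])
  ultimately show "jointly_surjective M C" by simp
qed (rule jointly_surjective_similar[OF sim M C])

text \<open>A column of a product depends only on the same column of the right factor, so selection
  commutes with the change of coordinates.\<close>

lemma mult_select_cols:
  assumes "Q \<in> carrier_mat n k" "B \<in> carrier_mat k m"
  shows "Q * select_cols B S = select_cols (Q * B) S"
  by (rule eq_matI)
    (use assms in \<open>auto simp: select_cols_def dim_submatrix submatrix_index pick_UNIV pick_le
      scalar_prod_def intro!: sum.cong\<close>)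

section \<open>Zero rows and range of a shifted Jordan matrix\<close>

text \<open>Extracts what backward substitution requires: the matrix is upper bidiagonal, and a
  superdiagonal 1 occurs only inside a block, where the diagonal is constant.\<close>

lemma jordan_matrix_entries:
  fixes n_as :: "(nat \<times> 'a :: zero_neq_one) list"
  defines "J \<equiv> jordan_matrix n_as"
  shows "\<And>i j. i < dim_row J \<Longrightarrow> j < dim_row J \<Longrightarrow> j \<noteq> i \<Longrightarrow> j \<noteq> Suc i \<Longrightarrow> J $$ (i, j) = 0"
    and "\<And>i. Suc i < dim_row J \<Longrightarrow>
      J $$ (i, Suc i) = 0 \<or> J $$ (i, Suc i) = 1 \<and> J $$ (Suc i, Suc i) = J $$ (i, i)"
proof -
  have "(i < dim_row J \<longrightarrow> j < dim_row J \<longrightarrow> j \<noteq> i \<longrightarrow> j \<noteq> Suc i \<longrightarrow> J $$ (i, j) = 0) \<and>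
    (Suc i < dim_row J \<longrightarrow>
      J $$ (i, Suc i) = 0 \<or> J $$ (i, Suc i) = 1 \<and> J $$ (Suc i, Suc i) = J $$ (i, i))" for i j
    unfolding J_def
  proof (induction n_as arbitrary: i j)
    case Nil
    show ?case by simp
  next
    case (Cons na n_as)
    obtain k a where na: "na = (k, a)" by force
    define J where "J = jordan_matrix n_as"
    define J' where "J' = jordan_matrix ((k, a) # n_as)"
    define r where "r = dim_row J"
    have dim: "dim_row J' = k + r" "dim_col J = r" by (simp_all add: J'_def J_def r_def)
    have J': "J' $$ (i, j) = (if i < k then
        if j < k then if i = j then a else if Suc i = j then 1 else 0 else 0
        else if j < k then 0 else J $$ (i - k, j - k))" if "i < k + r" "j < k + r" for i j
      using that unfolding J'_def jordan_matrix_Cons J_def[symmetric]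
      by (auto simp: dim r_def) (auto simp: J_def)
    have IH1: "i < r \<Longrightarrow> j < r \<Longrightarrow> j \<noteq> i \<Longrightarrow> j \<noteq> Suc i \<Longrightarrow> J $$ (i, j) = 0"
      and IH2: "Suc i < r \<Longrightarrow>
        J $$ (i, Suc i) = 0 \<or> J $$ (i, Suc i) = 1 \<and> J $$ (Suc i, Suc i) = J $$ (i, i)" for i j
      using Cons.IH[of i j] unfolding J_def[symmetric] r_def by blast+
    have "J' $$ (i, j) = 0" if "i < k + r" "j < k + r" "j \<noteq> i" "j \<noteq> Suc i"
      using that IH1[of "i - k" "j - k"] by (auto simp: J')
    \<comment> \<open>At the border \<open>Suc i = k\<close> the superdiagonal entry lies in the
      zero off-diagonal block.\<close>
    moreover have "J' $$ (i, Suc i) = 0 \<or> J' $$ (i, Suc i) = 1 \<and> J' $$ (Suc i, Suc i) = J' $$ (i, i)"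
      if "Suc i < k + r"
      using that IH2[of "i - k"] by (cases "i < k") (auto simp: J' Suc_diff_le)
    ultimately show ?case unfolding na J'_def[symmetric] dim by blast
  qed
  thus "\<And>i j. i < dim_row J \<Longrightarrow> j < dim_row J \<Longrightarrow> j \<noteq> i \<Longrightarrow> j \<noteq> Suc i \<Longrightarrow> J $$ (i, j) = 0"
    and "\<And>i. Suc i < dim_row J \<Longrightarrow>
      J $$ (i, Suc i) = 0 \<or> J $$ (i, Suc i) = 1 \<and> J $$ (Suc i, Suc i) = J $$ (i, i)"
    by blast+
qed

text \<open>Backward substitution where the diagonal entry is nonzero; where it vanishes, the
  superdiagonal entry 1 of the preceding row determines the unknown.\<close>

lemma bidiagonal_solvable:
  fixes d c w :: "nat \<Rightarrow> 'a :: field"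
  assumes block: "\<And>i. c i = 0 \<or> c i = 1 \<and> d (Suc i) = d i"
    and w: "\<And>i. d i = 0 \<Longrightarrow> c i = 0 \<Longrightarrow> w i = 0"
    and c: "\<And>i. Suc i \<ge> n \<Longrightarrow> c i = 0"
  shows "\<exists>x. \<forall>i<n. d i * x i + c i * x (Suc i) = w i"
proof -
  have "k \<le> n \<Longrightarrow> \<exists>x. (\<forall>i<n. n - k \<le> i \<longrightarrow> d i \<noteq> 0 \<longrightarrow> d i * x i + c i * x (Suc i) = w i)" for k
  proof (induction k)
    case (Suc k)
    then obtain x where x: "\<forall>i<n. n - k \<le> i \<longrightarrow> d i \<noteq> 0 \<longrightarrow> d i * x i + c i * x (Suc i) = w i"
      by auto
    define r where "r = n - Suc k"
    show ?case
    proof (intro exI allI impI)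
      fix i assume i: "i < n" "n - Suc k \<le> i" "d i \<noteq> 0"
      \<comment> \<open>Changing \<open>x\<close> at \<open>r\<close> cannot disturb a later row,
        which involves only larger indices.\<close>
      show "d i * (x(r := (w r - c r * x (Suc r)) / d r)) i
          + c i * (x(r := (w r - c r * x (Suc r)) / d r)) (Suc i) = w i"
      proof (cases "i = r")
        case True
        thus ?thesis using i by simp
      next
        case False
        hence "n - k \<le> i" using i unfolding r_def by linarith
        thus ?thesis using x i False unfolding r_def by auto
      qed
    qed
  qed simp
  from this[of n] obtain x where x: "\<forall>i<n. d i \<noteq> 0 \<longrightarrow> d i * x i + c i * x (Suc i) = w i"
    by auto
  \<comment> \<open>When \<open>d i = 0\<close> and row \<open>i - 1\<close> has superdiagonal 1,
    that row demands the value \<open>w (i - 1)\<close>. At \<open>i = 0\<close> the default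
    \<open>w 0\<close> is harmless: it is only multiplied by \<open>d 0 = 0\<close>.\<close>
  define y where "y i = (if d i \<noteq> 0 then x i else w (i - 1))" for i
  have "d i * y i + c i * y (Suc i) = w i" if "i < n" for i
    using x that block[of i] w[of i] unfolding y_def by auto
  thus ?thesis by blast
qed

text \<open>Only the diagonal and superdiagonal entries of a row can be nonzero after the shift; the
  guard \<open>Suc i < dim_row J\<close> accounts for the last row.\<close>

lemma zero_rows_jordan_matrix:
  fixes n_as :: "(nat \<times> complex) list"
  defines "J \<equiv> jordan_matrix n_as"
  shows "zero_rows J \<mu> =
    {i. i < dim_row J \<and> J $$ (i, i) = \<mu> \<and> (Suc i < dim_row J \<longrightarrow> J $$ (i, Suc i) = 0)}"
proof -
  have sq: "dim_col J = dim_row J" by (simp add: J_def)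
  have "row (J - \<mu> \<cdot>\<^sub>m 1\<^sub>m (dim_row J)) i = 0\<^sub>v (dim_col J) \<longleftrightarrow>
      J $$ (i, i) = \<mu> \<and> (Suc i < dim_row J \<longrightarrow> J $$ (i, Suc i) = 0)" (is "?L \<longleftrightarrow> ?R")
    if i: "i < dim_row J" for i
  proof -
    have "?L \<longleftrightarrow> (\<forall>j<dim_row J. J $$ (i, j) - (if i = j then \<mu> else 0) = 0)"
      unfolding vec_eq_iff using i by (auto simp: sq)
    also have "\<dots> \<longleftrightarrow> ?R"
    proof
      assume z: "\<forall>j<dim_row J. J $$ (i, j) - (if i = j then \<mu> else 0) = 0"
      show ?R using z[rule_format, OF i] z[rule_format, of "Suc i"] by auto
    next
      assume r: ?R
      show "\<forall>j<dim_row J. J $$ (i, j) - (if i = j then \<mu> else 0) = 0"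
      proof (intro allI impI)
        fix j assume "j < dim_row J"
        thus "J $$ (i, j) - (if i = j then \<mu> else 0) = 0"
          using r jordan_matrix_entries(1)[of i n_as j, folded J_def] i
          by (cases "j = i"; cases "j = Suc i") simp_all
      qed
    qed
    finally show ?thesis .
  qed
  thus ?thesis unfolding zero_rows_def by blast
qed

text \<open>A zero row forces a zero component of the image. Conversely, these are the only
  obstructions to solving the bidiagonal system.\<close>

lemma jordan_shift_range:
  fixes n_as :: "(nat \<times> complex) list" and \<mu> :: complex
  defines "J \<equiv> jordan_matrix n_as"
  defines "N \<equiv> J - \<mu> \<cdot>\<^sub>m 1\<^sub>m (dim_row J)"
  assumes w: "w \<in> carrier_vec (dim_row J)"
  shows "(\<exists>x\<in>carrier_vec (dim_row J). N *\<^sub>v x = w) \<longleftrightarrow> (\<forall>i\<in>zero_rows J \<mu>. w $ i = 0)"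
proof
  assume "\<exists>x\<in>carrier_vec (dim_row J). N *\<^sub>v x = w"
  thus "\<forall>i\<in>zero_rows J \<mu>. w $ i = 0"
    by (auto simp: zero_rows_def N_def J_def)
next
  assume w0: "\<forall>i\<in>zero_rows J \<mu>. w $ i = 0"
  define n where "n = dim_row J"
  have sq: "dim_col J = n" by (simp add: J_def n_def)
  \<comment> \<open>The defaults (diagonal 1, superdiagonal 0) make the hypotheses of
    \<open>bidiagonal_solvable\<close> hold at all indices.\<close>
  define d where "d i = (if i < n then J $$ (i, i) - \<mu> else 1)" for i
  define c where "c i = (if Suc i < n then J $$ (i, Suc i) else 0)" for i
  have "\<exists>x. \<forall>i<n. d i * x i + c i * x (Suc i) = (if i < n then w $ i else 0)"
  proof (rule bidiagonal_solvable)
    show "c i = 0 \<or> c i = 1 \<and> d (Suc i) = d i" for i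
      using jordan_matrix_entries(2)[of i n_as] unfolding c_def d_def n_def J_def by auto
    show "(if i < n then w $ i else 0) = 0" if "d i = 0" "c i = 0" for i
    proof -
      have "i \<in> zero_rows J \<mu>" if "i < n"
        using that \<open>d i = 0\<close> \<open>c i = 0\<close>
        unfolding zero_rows_jordan_matrix J_def c_def d_def n_def by auto
      thus ?thesis using w0 by auto
    qed
    show "c i = 0" if "Suc i \<ge> n" for i using that by (simp add: c_def)
  qed
  then obtain x where x: "d i * x i + c i * x (Suc i) = w $ i" if "i < n" for i by auto
  have "N *\<^sub>v vec n x = w"
  proof (rule eq_vecI)
    fix i assume "i < dim_vec w"
    hence i: "i < n" using w by (simp add: n_def)
    have Nij: "N $$ (i, j) = (if j = i then d i else if j = Suc i then c i else 0)" if "j < n" for j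
      using that i jordan_matrix_entries(1)[of i n_as j]
      by (auto simp: N_def n_def[symmetric] d_def c_def sq) (simp_all add: J_def n_def)
    have "(N *\<^sub>v vec n x) $ i = (\<Sum>j<n. N $$ (i, j) * x j)"
      using i by (simp add: N_def n_def[symmetric] sq scalar_prod_def lessThan_atLeast0)
    also have "\<dots> = (\<Sum>j<n. (if j = i then d i * x i else 0) + (if j = Suc i then c i * x (Suc i) else 0))"
      by (rule sum.cong) (auto simp: Nij)
    also have "\<dots> = d i * x i + c i * x (Suc i)"
      using i by (simp add: sum.distrib c_def)
    finally show "(N *\<^sub>v vec n x) $ i = w $ i" using x[OF i] by simp
  qed (use w in \<open>simp add: N_def\<close>)
  thus "\<exists>x\<in>carrier_vec (dim_row J). N *\<^sub>v x = w" unfolding n_def by (metis vec_carrier)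
qed

section \<open>Geometric multiplicity as the number of zero rows\<close>

text \<open>In the first block every row but the last has a superdiagonal 1, so only row
  \<open>k - 1\<close> can vanish. Positivity of \<open>k\<close> keeps the truncated subtraction
  meaningful.\<close>

lemma zero_rows_jordan_Cons:
  fixes n_as :: "(nat \<times> complex) list"
  assumes k: "k > 0"
  shows "zero_rows (jordan_matrix ((k, a) # n_as)) \<mu> =
    (if a = \<mu> then {k - 1} else {}) \<union> (+) k ` zero_rows (jordan_matrix n_as) \<mu>"
proof -
  define J where "J = jordan_matrix n_as"
  define J' where "J' = jordan_matrix ((k, a) # n_as)"
  have J': "J' = four_block_mat (jordan_block k a) (0\<^sub>m k (dim_row J)) (0\<^sub>m (dim_row J) k) J"
    unfolding J_def J'_def jordan_matrix_Cons by simp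
  have dim: "dim_row J' = k + dim_row J" "dim_col J = dim_row J" unfolding J' by (auto simp: J_def)
  have "i \<in> zero_rows J' \<mu> \<longleftrightarrow> a = \<mu> \<and> i = k - 1" if "i < k" for i
  proof (cases "Suc i < k")
    case True
    hence "J' $$ (i, Suc i) = 1" "Suc i < dim_row J'" by (auto simp: J' dim)
    thus ?thesis using True unfolding J'_def zero_rows_jordan_matrix by auto
  next
    case False
    hence "i = k - 1" "J' $$ (i, i) = a" "Suc i < dim_row J' \<Longrightarrow> J' $$ (i, Suc i) = 0"
      using that by (auto simp: J' dim(2))
    thus ?thesis using that unfolding J'_def zero_rows_jordan_matrix by (auto simp: dim[unfolded J'_def])
  qed
  moreover have "k + i \<in> zero_rows J' \<mu> \<longleftrightarrow> i \<in> zero_rows J \<mu>" for i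
    unfolding J'_def J_def zero_rows_jordan_matrix
    unfolding J'_def[symmetric] J_def[symmetric] dim by (auto simp: J' dim)
  ultimately have "i \<in> zero_rows J' \<mu> \<longleftrightarrow>
      i \<in> (if a = \<mu> then {k - 1} else {}) \<union> (+) k ` zero_rows J \<mu>" for i
    using k by (cases "i < k") (auto simp: image_iff not_less le_iff_add)
  thus ?thesis unfolding J_def J'_def by blast
qed

text \<open>Every nonempty block for \<open>\<mu>\<close> contributes one zero row and one dimension
  of the eigenspace.\<close>

lemma card_zero_rows_jordan_matrix:
  fixes n_as :: "(nat \<times> complex) list"
  assumes "0 \<notin> fst ` set n_as"
  shows "card (zero_rows (jordan_matrix n_as) \<mu>) = dim_gen_eigenspace (jordan_matrix n_as) \<mu> 1"
  using assms
proof (induction n_as)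
  case Nil
  show ?case by (simp add: dim_gen_eigenspace_jordan_matrix zero_rows_def)
next
  case (Cons na n_as)
  obtain k a where na: "na = (k, a)" by force
  have k: "k > 0" using Cons.prems na by auto
  have "finite (zero_rows (jordan_matrix n_as) \<mu>)" unfolding zero_rows_def by simp
  moreover have "(if a = \<mu> then {k - 1} else {}) \<inter> (+) k ` zero_rows (jordan_matrix n_as) \<mu> = {}"
    using k by auto
  ultimately have "card (zero_rows (jordan_matrix (na # n_as)) \<mu>) =
      (if a = \<mu> then 1 else 0) + card (zero_rows (jordan_matrix n_as) \<mu>)"
    unfolding na zero_rows_jordan_Cons[OF k] by (subst card_Un_disjoint) (auto simp: card_image)
  also have "\<dots> = dim_gen_eigenspace (jordan_matrix (na # n_as)) \<mu> 1"
    using Cons k unfolding dim_gen_eigenspace_jordan_matrix na by simp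
  finally show ?case .
qed

lemma shift_eq_char_matrix:
  assumes "A \<in> carrier_mat n n"
  shows "A - \<mu> \<cdot>\<^sub>m 1\<^sub>m (dim_row A) = char_matrix A \<mu>"
  by (rule eq_matI) (use assms in \<open>auto simp: char_matrix_def\<close>)

text \<open>The dimension of the eigenspace is invariant under similarity, so it can be counted on
  \<open>J\<close>.\<close>

lemma geom_mult_eq_card_zero_rows:
  assumes A: "A \<in> carrier_mat n n" and "jordan_decomposition A P J Pinv"
  shows "geom_mult A \<mu> = card (zero_rows J \<mu>)"
proof -
  obtain n_as where sim: "similar_mat_wit A J P Pinv"
    and n_as: "0 \<notin> fst ` set n_as" and J: "J = jordan_matrix n_as"
    using assms(2) unfolding jordan_decomposition_def by blast
  have "geom_mult A \<mu> = dim_gen_eigenspace A \<mu> 1"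
    unfolding geom_mult_def shift_eq_char_matrix[OF A] dim_gen_eigenspace_def
    using A by (simp add: char_matrix_def)
  also have "\<dots> = dim_gen_eigenspace J \<mu> 1"
    using dim_gen_eigenspace_similar sim unfolding similar_mat_def by metis
  finally show ?thesis using card_zero_rows_jordan_matrix[OF n_as] J by simp
qed

section \<open>The rank condition at one eigenvalue\<close>

lemma select_cols_carrier:
  assumes "C \<in> carrier_mat n m" "S \<subseteq> {..<m}"
  shows "select_cols C S \<in> carrier_mat n (card S)"
proof -
  have "{j. j < m \<and> j \<in> S} = S" using assms by auto
  thus ?thesis using assms by (intro carrier_matI) (auto simp: select_cols_def dim_submatrix)
qed

lemma full_row_rank_select_cols:
  assumes C: "C \<in> carrier_mat n m" and G: "G \<subseteq> {..<n}" and S: "S \<subseteq> {..<m}"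
  shows "full_row_rank (\<lambda>i j. select_cols C S $$ (i, j)) G {..<card S} \<longleftrightarrow>
    full_row_rank (\<lambda>i j. C $$ (i, j)) G S"
proof -
  have sets: "{j. j < dim_col C \<and> j \<in> S} = S" using C S by auto
  have "full_row_rank (\<lambda>i j. select_cols C S $$ (i, j)) G {..<card S} \<longleftrightarrow>
      full_row_rank (\<lambda>i j. C $$ (i, pick S j)) G {..<card S}"
    by (rule full_row_rank_cong)
      (use C G in \<open>auto simp: select_cols_def submatrix_def sets pick_UNIV subset_iff\<close>)
  thus ?thesis
    using full_row_rank_reindex[OF bij_betw_id[of G] bij_betw_pick[OF S], of "\<lambda>i j. C $$ (i, j)"]
    by simp
qed

text \<open>An \<open>x\<close> exists for given \<open>w\<close> and \<open>u\<close> exactly when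
  \<open>w - C *\<^sub>v u\<close> lies in the range of the shifted Jordan matrix. The range
  description eliminates \<open>x\<close> and leaves equations on the zero rows.\<close>

lemma jointly_surjective_jordan_iff:
  fixes n_as :: "(nat \<times> complex) list" and \<mu> :: complex
  defines "J \<equiv> jordan_matrix n_as"
  assumes C: "C \<in> carrier_mat (dim_row J) l"
  shows "jointly_surjective (J - \<mu> \<cdot>\<^sub>m 1\<^sub>m (dim_row J)) C \<longleftrightarrow>
    full_row_rank (\<lambda>i j. C $$ (i, j)) (zero_rows J \<mu>) {..<l}"
proof -
  define n where "n = dim_row J"
  define N where "N = J - \<mu> \<cdot>\<^sub>m 1\<^sub>m (dim_row J)"
  have N: "N \<in> carrier_mat n n" unfolding N_def n_def J_def by (intro carrier_matI) simp_all
  have C': "C \<in> carrier_mat n l" using C by (simp add: n_def)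
  have range: "(\<exists>x\<in>carrier_vec n. N *\<^sub>v x = v) \<longleftrightarrow> (\<forall>i\<in>zero_rows J \<mu>. v $ i = 0)"
    if "v \<in> carrier_vec n" for v
    using jordan_shift_range[of v n_as \<mu>] that unfolding N_def n_def J_def by simp
  have entry: "(C *\<^sub>v u) $ i = (\<Sum>j<l. C $$ (i, j) * u $ j)" if "i < n" "u \<in> carrier_vec l" for i u
    using that C' by (simp add: scalar_prod_def lessThan_atLeast0)
  have lt: "i < n" if "i \<in> zero_rows J \<mu>" for i using that by (simp add: zero_rows_def n_def)
  have "N *\<^sub>v x + C *\<^sub>v u = w \<longleftrightarrow> N *\<^sub>v x = w - C *\<^sub>v u"
    if "w \<in> carrier_vec n" "u \<in> carrier_vec l" for w x u
  proof -
    have "dim_vec (N *\<^sub>v x) = n" "dim_vec (C *\<^sub>v u) = n" "dim_vec w = n" using that N C' by auto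
    thus ?thesis unfolding vec_eq_iff by (auto simp: algebra_simps simp del: index_mult_mat_vec)
  qed
  hence "jointly_surjective N C \<longleftrightarrow> (\<forall>w\<in>carrier_vec n. \<exists>u\<in>carrier_vec l. \<exists>x\<in>carrier_vec n.
      N *\<^sub>v x = w - C *\<^sub>v u)"
    using N C' unfolding jointly_surjective_def by simp blast
  also have "\<dots> \<longleftrightarrow> (\<forall>w\<in>carrier_vec n. \<exists>u\<in>carrier_vec l. \<forall>i\<in>zero_rows J \<mu>.
      (\<Sum>j<l. C $$ (i, j) * u $ j) = w $ i)"
  proof (intro ball_cong bex_cong refl)
    fix w u :: "complex vec" assume wu: "w \<in> carrier_vec n" "u \<in> carrier_vec l"
    have "w - C *\<^sub>v u \<in> carrier_vec n" using wu C' by (intro minus_carrier_vec) auto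
    thus "(\<exists>x\<in>carrier_vec n. N *\<^sub>v x = w - C *\<^sub>v u) \<longleftrightarrow>
        (\<forall>i\<in>zero_rows J \<mu>. (\<Sum>j<l. C $$ (i, j) * u $ j) = w $ i)"
      using wu lt C' by (auto simp: range entry simp del: index_mult_mat_vec)
  qed
  also have "\<dots> \<longleftrightarrow> full_row_rank (\<lambda>i j. C $$ (i, j)) (zero_rows J \<mu>) {..<l}" (is "?L \<longleftrightarrow> ?R")
  proof
    assume L: ?L
    show ?R unfolding full_row_rank_def
    proof
      fix w
      from L obtain u where "\<forall>i\<in>zero_rows J \<mu>. (\<Sum>j<l. C $$ (i, j) * u $ j) = vec n w $ i"
        \<comment> \<open>Truncating the function \<open>w\<close> to a vector of length
          \<open>n\<close> loses nothing, as all zero rows lie below \<open>n\<close>.\<close>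
        by (metis vec_carrier)
      thus "\<exists>u. \<forall>i\<in>zero_rows J \<mu>. (\<Sum>j<l. C $$ (i, j) * u j) = w i"
        using lt by (intro exI[of _ "\<lambda>j. u $ j"]) simp
    qed
  next
    assume R: ?R
    show ?L
    proof
      fix w :: "complex vec"
      obtain u where "\<forall>i\<in>zero_rows J \<mu>. (\<Sum>j<l. C $$ (i, j) * u j) = w $ i"
        using full_row_rankD[OF R, of "\<lambda>i. w $ i"] by blast
      thus "\<exists>u\<in>carrier_vec l. \<forall>i\<in>zero_rows J \<mu>. (\<Sum>j<l. C $$ (i, j) * u $ j) = w $ i"
        by (intro bexI[of _ "vec l u"]) auto
    qed
  qed
  finally show ?thesis unfolding N_def .
qed

text \<open>Pass to Jordan coordinates, restrict to the zero rows, and extract a square full-rank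
  part. Monotonicity in the column set gives the converse of the extraction.\<close>

lemma rank_condition_iff_admissible_subset:
  assumes A: "A \<in> carrier_mat n n" and C: "C \<in> carrier_mat n m"
    and jd: "jordan_decomposition A P J Pinv" and S: "S \<subseteq> {..<m}"
  shows "mat_rank (append_cols (A - \<mu> \<cdot>\<^sub>m 1\<^sub>m n) (select_cols C S)) = n \<longleftrightarrow>
    (\<exists>T\<in>admissible_subsets A J (Pinv * C) \<mu>. T \<subseteq> S)"
proof -
  obtain n_as where sim: "similar_mat_wit A J P Pinv" and J: "J = jordan_matrix n_as"
    using jd unfolding jordan_decomposition_def by blast
  note wit = similar_mat_witD2[OF A sim]
  define D where "D = Pinv * C"
  define G where "G = zero_rows J \<mu>"
  have D: "D \<in> carrier_mat n m" using wit C by (simp add: D_def)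
  have G: "G \<subseteq> {..<n}" using wit by (auto simp: G_def zero_rows_def)
  have fin: "finite G" "finite S" using G S finite_subset by auto
  have dimJ: "dim_row J = n" "dim_row A = n" using wit by auto
  have sim': "similar_mat_wit (A - \<mu> \<cdot>\<^sub>m 1\<^sub>m n) (J - \<mu> \<cdot>\<^sub>m 1\<^sub>m n) P Pinv"
    using similar_mat_wit_char_matrix[OF sim, of \<mu>]
      shift_eq_char_matrix[OF wit(4), of \<mu>] shift_eq_char_matrix[OF wit(5), of \<mu>]
    by (simp add: dimJ)
  have AC: "A - \<mu> \<cdot>\<^sub>m 1\<^sub>m n \<in> carrier_mat n n" "select_cols C S \<in> carrier_mat n (card S)"
    using A select_cols_carrier[OF C S] by auto
  have "mat_rank (append_cols (A - \<mu> \<cdot>\<^sub>m 1\<^sub>m n) (select_cols C S)) = n \<longleftrightarrow>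
      jointly_surjective (J - \<mu> \<cdot>\<^sub>m 1\<^sub>m n) (select_cols D S)"
    unfolding mat_rank_append_cols_iff[OF AC] jointly_surjective_similar_iff[OF sim' AC] D_def
    by (simp add: mult_select_cols[OF wit(7) C])
  also have "\<dots> \<longleftrightarrow> full_row_rank (\<lambda>i j. select_cols D S $$ (i, j)) G {..<card S}"
    using jointly_surjective_jordan_iff[of "select_cols D S" n_as "card S" \<mu>]
      select_cols_carrier[OF D S] dimJ
    unfolding J G_def by simp
  also have "\<dots> \<longleftrightarrow> full_row_rank (\<lambda>i j. D $$ (i, j)) G S"
    by (rule full_row_rank_select_cols[OF D G S])
  also have "\<dots> \<longleftrightarrow> (\<exists>T\<subseteq>S. card T = card G \<and> full_row_rank (\<lambda>i j. D $$ (i, j)) G T)"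
    using full_row_rank_extract[OF fin] full_row_rank_mono[OF _ _ fin(2)] by blast
  also have "\<dots> \<longleftrightarrow> (\<exists>T\<in>admissible_subsets A J D \<mu>. T \<subseteq> S)"
  proof -
    have "T \<in> admissible_subsets A J D \<mu> \<longleftrightarrow>
        card T = card G \<and> full_row_rank (\<lambda>i j. D $$ (i, j)) G T" if "T \<subseteq> S" for T
      using that S D G mat_rank_submatrix_eq_card_iff[of G D T]
      unfolding admissible_subsets_def geom_mult_eq_card_zero_rows[OF A jd] G_def[symmetric] by auto
    thus ?thesis by blast
  qed
  finally show ?thesis unfolding D_def .
qed

lemma selection_feasible_iff:
  assumes A: "A \<in> carrier_mat n n" and B: "B \<in> carrier_mat n m"
    and jd: "jordan_decomposition (cmat A) P J Pinv"
  shows "selection_feasible A B S \<longleftrightarrow> S \<subseteq> {..<m} \<and>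
    (\<forall>\<mu>\<in>spectrum (cmat A). \<exists>T\<in>admissible_subsets (cmat A) J (Pinv * cmat B) \<mu>. T \<subseteq> S)"
  using rank_condition_iff_admissible_subset[of "cmat A" n "cmat B" m, OF _ _ jd] A B
  unfolding selection_feasible_def by auto

section \<open>The constraints of the binary program\<close>

lemma scalar_prod_binary:
  assumes "y \<in> binary_vecs m"
  shows "vec m (\<lambda>j. if j \<in> T then 1 else 0) \<bullet> y = int (card (T \<inter> supp_vec y))"
proof -
  have y: "dim_vec y = m" "\<And>j. j < m \<Longrightarrow> y $ j = (if j \<in> supp_vec y then 1 else 0)"
    using assms by (auto simp: binary_vecs_def supp_vec_def)
  have "vec m (\<lambda>j. if j \<in> T then 1 else 0) \<bullet> y =
      (\<Sum>j\<in>{0..<m}. if j \<in> T \<inter> supp_vec y then 1 else 0)"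
    unfolding scalar_prod_def y(1) by (rule sum.cong) (auto simp: y(2))
  also have "\<dots> = int (card ({0..<m} \<inter> (T \<inter> supp_vec y)))" by (simp add: sum.If_cases Int_def)
  also have "{0..<m} \<inter> (T \<inter> supp_vec y) = T \<inter> supp_vec y"
    using y(1) by (auto simp: supp_vec_def)
  finally show ?thesis .
qed

lemma ones_scalar_prod_binary:
  assumes "y \<in> binary_vecs m"
  shows "ones_vec m \<bullet> y = int (card (supp_vec y))"
  using scalar_prod_binary[OF assms, of UNIV] by (simp add: ones_vec_def)

text \<open>A selected row compares \<open>card T\<close> with
  \<open>card (T \<inter> supp_vec y)\<close>, which forces \<open>T\<close> into the support; an
  unselected row only says that a cardinality is nonnegative. The sum constraint demands some
  selected row.\<close>

lemma ilp_block_iff: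
  assumes W: "is_incidence_mat m \<T> W" and \<T>: "\<And>T. T \<in> \<T> \<Longrightarrow> T \<subseteq> {..<m}"
    and y: "y \<in> binary_vecs m"
  shows "(\<exists>d\<in>binary_vecs (dim_row W). W *\<^sub>v y \<ge> hadamard (W *\<^sub>v ones_vec m) d \<and>
      ones_vec (dim_row W) \<bullet> d \<ge> 1) \<longleftrightarrow> (\<exists>T\<in>\<T>. T \<subseteq> supp_vec y)"
proof -
  obtain Ts where Ts: "set Ts = \<T>"
    and W_eq: "W = mat (length Ts) m (\<lambda>(k, j). if j \<in> Ts ! k then 1 else 0)"
    using W unfolding is_incidence_mat_def by blast
  have dim: "dim_row W = length Ts" by (simp add: W_eq)
  have row_W: "row W k = vec m (\<lambda>j. if j \<in> Ts ! k then 1 else 0)" if "k < length Ts" for k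
    using that by (auto simp: W_eq)
  have Wv: "(W *\<^sub>v v) $ k = int (card (Ts ! k \<inter> supp_vec v))"
    if "k < length Ts" "v \<in> binary_vecs m" for k v
    using that scalar_prod_binary[OF that(2), of "Ts ! k"]
    by (simp add: dim row_W)
  have one: "ones_vec m \<in> binary_vecs m" "supp_vec (ones_vec m) = {..<m}"
    by (auto simp: ones_vec_def binary_vecs_def supp_vec_def)
  have fin: "finite (Ts ! k)" and W1: "(W *\<^sub>v ones_vec m) $ k = int (card (Ts ! k))"
    if "k < length Ts" for k
  proof -
    have "Ts ! k \<subseteq> {..<m}" using \<T> Ts that nth_mem by blast
    thus "finite (Ts ! k)" "(W *\<^sub>v ones_vec m) $ k = int (card (Ts ! k))"
      using Wv[OF that one(1)] one(2) by (auto simp: Int_absorb2 finite_subset)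
  qed
  have row: "(W *\<^sub>v ones_vec m) $ k \<le> (W *\<^sub>v y) $ k \<longleftrightarrow> Ts ! k \<subseteq> supp_vec y"
    if "k < length Ts" for k
  proof -
    have "card (Ts ! k) \<le> card (Ts ! k \<inter> supp_vec y) \<longleftrightarrow> Ts ! k \<subseteq> supp_vec y"
      using card_seteq[OF fin[OF that], of "Ts ! k \<inter> supp_vec y"] by (auto simp: Int_absorb2)
    thus ?thesis using Wv[OF that y] W1[OF that] by simp
  qed
  have le: "W *\<^sub>v y \<ge> hadamard (W *\<^sub>v ones_vec m) d \<longleftrightarrow>
      (\<forall>k<length Ts. d $ k = 1 \<longrightarrow> Ts ! k \<subseteq> supp_vec y)"
    if d: "d \<in> binary_vecs (length Ts)" for d
  proof -
    have "(W *\<^sub>v ones_vec m) $ k * d $ k \<le> (W *\<^sub>v y) $ k \<longleftrightarrow> (d $ k = 1 \<longrightarrow> Ts ! k \<subseteq> supp_vec y)"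
      if k: "k < length Ts" for k
    proof (cases "d $ k = 1")
      case False
      hence "d $ k = 0" using d k by (auto simp: binary_vecs_def)
      thus ?thesis using Wv[OF k y] by simp
    qed (use row[OF k] in simp)
    thus ?thesis
      by (auto simp: less_eq_vec_def hadamard_def dim simp del: index_mult_mat_vec)
  qed
  have ge1: "ones_vec (length Ts) \<bullet> d \<ge> 1 \<longleftrightarrow> (\<exists>k<length Ts. d $ k = 1)"
    if d: "d \<in> binary_vecs (length Ts)" for d
  proof -
    have "ones_vec (length Ts) \<bullet> d \<ge> 1 \<longleftrightarrow> supp_vec d \<noteq> {}"
      unfolding ones_scalar_prod_binary[OF d]
      by (auto simp: supp_vec_def Suc_le_eq card_gt_0_iff)
    also have "\<dots> \<longleftrightarrow> (\<exists>k<length Ts. d $ k = 1)"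
      using d by (auto simp: supp_vec_def binary_vecs_def) blast
    finally show ?thesis .
  qed
  show ?thesis
  proof
    assume "\<exists>d\<in>binary_vecs (dim_row W). W *\<^sub>v y \<ge> hadamard (W *\<^sub>v ones_vec m) d \<and>
      ones_vec (dim_row W) \<bullet> d \<ge> 1"
    then obtain k where "k < length Ts" "Ts ! k \<subseteq> supp_vec y"
      using le ge1 unfolding dim by blast
    thus "\<exists>T\<in>\<T>. T \<subseteq> supp_vec y" using Ts nth_mem by blast
  next
    assume "\<exists>T\<in>\<T>. T \<subseteq> supp_vec y"
    then obtain k where k: "k < length Ts" "Ts ! k \<subseteq> supp_vec y"
      using Ts by (metis in_set_conv_nth)
    \<comment> \<open>Selecting row \<open>k\<close> alone imposes no condition beyond the one
      already known to hold.\<close>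
    define d :: "int vec" where "d = unit_vec (length Ts) k"
    have "d \<in> binary_vecs (length Ts)" using k by (auto simp: d_def binary_vecs_def)
    moreover have "d $ i = 1 \<longleftrightarrow> i = k" if "i < length Ts" for i
      using that k by (simp add: d_def)
    ultimately show "\<exists>d\<in>binary_vecs (dim_row W). W *\<^sub>v y \<ge> hadamard (W *\<^sub>v ones_vec m) d \<and>
      ones_vec (dim_row W) \<bullet> d \<ge> 1"
      unfolding dim using k le ge1 by blast
  qed
qed

text \<open>The blocks share only \<open>y\<close>, so the vectors \<open>d i\<close> can be chosen
  independently of each other.\<close>

lemma ex_ilp_feasible_iff:
  assumes "\<And>i. i < p \<Longrightarrow> is_incidence_mat m (\<T> i) (W i)"
    and "\<And>i T. i < p \<Longrightarrow> T \<in> \<T> i \<Longrightarrow> T \<subseteq> {..<m}"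
  shows "(\<exists>d. ilp_feasible m p W (y, d)) \<longleftrightarrow>
    y \<in> binary_vecs m \<and> (\<forall>i<p. \<exists>T\<in>\<T> i. T \<subseteq> supp_vec y)"
proof -
  define Q where "Q i d \<longleftrightarrow> d \<in> binary_vecs (dim_row (W i)) \<and>
    W i *\<^sub>v y \<ge> hadamard (W i *\<^sub>v ones_vec m) d \<and> ones_vec (dim_row (W i)) \<bullet> d \<ge> 1" for i d
  have "ilp_feasible m p W (y, d) \<longleftrightarrow> y \<in> binary_vecs m \<and> (\<forall>i<p. Q i (d i))" for d
    unfolding ilp_feasible_def Q_def by blast
  moreover have "(\<exists>d. \<forall>i<p. Q i (d i)) \<longleftrightarrow> (\<forall>i<p. \<exists>d. Q i d)"
    by metis
  moreover have "(\<exists>d. Q i d) \<longleftrightarrow> (\<exists>T\<in>\<T> i. T \<subseteq> supp_vec y)" if "i < p" "y \<in> binary_vecs m" for i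
    using ilp_block_iff[OF assms(1)[OF that(1)] assms(2)[OF that(1)] that(2)] unfolding Q_def by auto
  ultimately show ?thesis by auto
qed

section \<open>Transfer of optimal solutions\<close>

text \<open>\<open>s\<close> may identify several feasible points, here those that differ only in
  \<open>d\<close>. Since \<open>is_arg_min\<close> speaks of strict improvement, preserving strict
  comparisons suffices, even between different value types.\<close>

lemma is_arg_min_transfer:
  fixes f :: "'a \<Rightarrow> 'c :: order" and g :: "'b \<Rightarrow> 'd :: order"
  assumes feas: "{S. P S} = s ` {z. Q z}"
    and obj: "\<And>z z'. Q z \<Longrightarrow> Q z' \<Longrightarrow> g z' < g z \<longleftrightarrow> f (s z') < f (s z)"
  shows "{S. is_arg_min f P S} = s ` {z. is_arg_min g Q z}"
proof -
  have P: "P S \<longleftrightarrow> (\<exists>z. Q z \<and> S = s z)" for S using feas by blast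
  have "is_arg_min f P (s z) \<longleftrightarrow> is_arg_min g Q z" if "Q z" for z
    unfolding is_arg_min_def P using obj that by blast
  thus ?thesis unfolding is_arg_min_def P by blast
qed

theorem theorem1:
  fixes A B :: "real mat"
    and P J Pinv :: "complex mat"
    and lam :: "nat \<Rightarrow> complex"
    and W :: "nat \<Rightarrow> int mat"
    and n m p :: nat
  assumes "A \<in> carrier_mat n n"
    and "B \<in> carrier_mat n m"
    and "jordan_decomposition (cmat A) P J Pinv"
    and "bij_betw lam {..<p} (spectrum (cmat A))"
    and "\<And>i. i < p \<Longrightarrow>
      is_incidence_mat m (admissible_subsets (cmat A) J (Pinv * cmat B) (lam i)) (W i)"
  shows "{S. is_arg_min card (selection_feasible A B) S} =
         {supp_vec y | y d. is_arg_min (ilp_objective m) (ilp_feasible m p W) (y, d)}"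
proof -
  define \<T> where "\<T> i = admissible_subsets (cmat A) J (Pinv * cmat B) (lam i)" for i
  have \<T>_sub: "T \<subseteq> {..<m}" if "T \<in> \<T> i" for i T
    using that assms(2) by (auto simp: \<T>_def admissible_subsets_def)
  have spec: "spectrum (cmat A) = lam ` {..<p}" using assms(4) by (simp add: bij_betw_def)
  \<comment> \<open>The common condition to which both feasibility notions reduce.\<close>
  define hit where "hit S \<longleftrightarrow> (\<forall>i<p. \<exists>T\<in>\<T> i. T \<subseteq> S)" for S
  have sel: "selection_feasible A B S \<longleftrightarrow> S \<subseteq> {..<m} \<and> hit S" for S
    unfolding selection_feasible_iff[OF assms(1-3)] spec \<T>_def hit_def by auto
  have ilp: "(\<exists>d. ilp_feasible m p W (y, d)) \<longleftrightarrow>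
      y \<in> binary_vecs m \<and> hit (supp_vec y)" for y
    unfolding hit_def by (rule ex_ilp_feasible_iff) (use assms(5) \<T>_sub in \<open>auto simp: \<T>_def\<close>)
  have supp: "supp_vec ` binary_vecs m = Pow {..<m}"
  proof (intro equalityI subsetI)
    fix S assume "S \<in> Pow {..<m}"
    hence "S = supp_vec (vec m (\<lambda>j. if j \<in> S then 1 else 0))"
      by (auto simp: supp_vec_def split: if_splits)
    thus "S \<in> supp_vec ` binary_vecs m" by (rule image_eqI) (auto simp: binary_vecs_def)
  qed (auto simp: binary_vecs_def supp_vec_def)
  \<comment> \<open>Every subset of \<open>{..<m}\<close> is the support of a binary vector, and
    \<open>fst\<close> discards the auxiliary \<open>d\<close>.\<close>
  have feas: "{S. selection_feasible A B S} = (supp_vec \<circ> fst) ` {z. ilp_feasible m p W z}"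
  proof (intro equalityI subsetI)
    fix S assume "S \<in> {S. selection_feasible A B S}"
    hence S: "S \<in> supp_vec ` binary_vecs m" "hit S" unfolding supp by (simp_all add: sel)
    then obtain y where "y \<in> binary_vecs m" "S = supp_vec y" by blast
    with S(2) obtain d where "ilp_feasible m p W (y, d)" using ilp[of y] by blast
    thus "S \<in> (supp_vec \<circ> fst) ` {z. ilp_feasible m p W z}"
      by (intro image_eqI[of _ _ "(y, d)"]) (simp_all add: \<open>S = supp_vec y\<close>)
  next
    fix S assume "S \<in> (supp_vec \<circ> fst) ` {z. ilp_feasible m p W z}"
    then obtain y d where yd: "S = supp_vec y" "ilp_feasible m p W (y, d)" by auto
    hence y: "y \<in> binary_vecs m" "hit S" using ilp[of y] by blast+
    hence "S \<in> Pow {..<m}" unfolding supp[symmetric] using yd(1) by blast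
    thus "S \<in> {S. selection_feasible A B S}" using y(2) by (simp add: sel)
  qed
  have obj: "ilp_objective m z' < ilp_objective m z \<longleftrightarrow>
      card ((supp_vec \<circ> fst) z') < card ((supp_vec \<circ> fst) z)"
    if "ilp_feasible m p W z" "ilp_feasible m p W z'" for z z'
  proof -
    have "ilp_objective m x = int (card (supp_vec (fst x)))" if "ilp_feasible m p W x" for x
      using that ones_scalar_prod_binary[of "fst x" m]
      by (simp add: ilp_feasible_def ilp_objective_def split_beta)
    thus ?thesis using that by simp
  qed
  have "{S. is_arg_min card (selection_feasible A B) S} =
      (supp_vec \<circ> fst) ` {z. is_arg_min (ilp_objective m) (ilp_feasible m p W) z}"
    by (rule is_arg_min_transfer[OF feas]) (rule obj)
  also have "\<dots> = {supp_vec y | y d. is_arg_min (ilp_objective m) (ilp_feasible m p W) (y, d)}"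
    by force
  finally show ?thesis .
qed

end
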